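(* Let $R$ be a non-unital right artinian ring with the following properties: (i) for every $a\in R$ and every positive integer $n$, $2^n a=0$ implies $a=0$; (ii) the equation $2x^2-x=0$ has only the trivial solution $x=0$ in $R$. Let $S=RG$ be the group ring of the group $G=\{e,g\}$ of order $2$ over the ring $R$. Then $S$ is a right artinian ring which is not generalized right p.p.
   Context: Rings are associative; a non-unital ring is a ring that has no identity element. A right ideal of a (possibly non-unital) ring $R$ is an additive subgroup $I$ with $IR\subseteq I$; $R$ is right artinian if it satisfies the descending chain condition on right ideals. For an integer $m$ and $a\in R$, $ma$ denotes the integer multiple of $a$ in the additive group of $R$. The group ring $RG$ over a ring $R$ (not assumed to have an identity) consists of formal sums $\sum_{h\in G}a_h h$ with $a_h\in R$, finitely many nonzero, with componentwise addition and multiplication determined by $(ah)(bk)=(ab)(hk)$; here $e$ is the identity of $G$. For $x$ in a ring $S$, $r_S(x)=\{s\in S: xs=0\}$ is the right annihilator of $x$. A ring $S$ is called generalized right p.p. (generalized right principally projective, also called generalized right Rickart) if for every $x\in S$ there is a positive integer $n$, depending on $x$, such that $r_S(x^n)$ is generated as a right ideal by an idempotent, i.e. $r_S(x^n)=fS$ for some $f\in S$ with $f^2=f$. *)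

theory Defs
  imports "HOL-Library.Poly_Mapping"
begin

text \<open>
  The type class \<open>ring\<close> assumes associativity but no identity element, so \<open>'a::ring\<close> models the
  rings considered here. Ring properties are predicates on types.
\<close>

definition non_unital :: "'a::ring itself \<Rightarrow> bool" where
  "non_unital _ \<longleftrightarrow> \<not> (\<exists>u::'a. \<forall>x. u * x = x \<and> x * u = x)"

definition right_ideal :: "'a::ring set \<Rightarrow> bool" where
  "right_ideal I \<longleftrightarrow>
     0 \<in> I \<and> (\<forall>x\<in>I. \<forall>y\<in>I. x - y \<in> I) \<and> (\<forall>x\<in>I. \<forall>r. x * r \<in> I)"

definition right_artinian :: "'a::ring itself \<Rightarrow> bool" where
  "right_artinian _ \<longleftrightarrow>
     (\<forall>I :: nat \<Rightarrow> 'a set. (\<forall>n. right_ideal (I n)) \<and> (\<forall>n. I (Suc n) \<subseteq> I n)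
        \<longrightarrow> (\<exists>N. \<forall>n\<ge>N. I n = I N))"

text \<open>
  Without an identity element neither \<open>of_nat\<close> nor \<open>(^)\<close> is available. The power \<open>rpow x n\<close> is
  meaningful only for \<open>n > 0\<close>; for \<open>n = 0\<close> it takes the junk value \<open>x\<close>.
\<close>

definition nat_multiple :: "nat \<Rightarrow> 'a::ring \<Rightarrow> 'a" where
  "nat_multiple m a = (\<Sum>i<m. a)"

definition rpow :: "'a::ring \<Rightarrow> nat \<Rightarrow> 'a" where
  "rpow x n = ((\<lambda>y. y * x) ^^ (n - 1)) x"

definition right_annihilator :: "'a::ring \<Rightarrow> 'a set" where
  "right_annihilator x = {s. x * s = 0}"

definition generalized_right_pp :: "'a::ring itself \<Rightarrow> bool" where
  "generalized_right_pp _ \<longleftrightarrow>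
     (\<forall>x::'a. \<exists>n>0. \<exists>f. f * f = f \<and> right_annihilator (rpow x n) = {f * s | s. True})"

text \<open>
  The group ring of a group \<open>'g\<close>, written additively, over \<open>'a\<close>: finitely supported functions
  from \<open>'g\<close> to \<open>'a\<close> with pointwise addition and convolution as multiplication. The formal
  monomial \<open>a h\<close> is \<open>Poly_Mapping.single h a\<close>, and these multiply as required by \<open>mult_single\<close>.
  The class \<open>group_add\<close> does not assume commutativity.
\<close>

type_synonym ('a, 'g) group_ring = "'g \<Rightarrow>\<^sub>0 'a"

end

theory Submission
  imports Defs
begin

text \<open>
  Why the theorem holds. The ring \<open>R\<close> has no nonzero idempotent. Indeed the descending chain
  \<open>R \<supseteq> 2R \<supseteq> 4R \<supseteq> \<dots>\<close> of right ideals is eventually constant, so \<open>2\<^sup>N a = 2\<^sup>N\<^sup>+\<^sup>1 b\<close> for some \<open>b\<close>,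
  and cancelling \<open>2\<^sup>N\<close> gives \<open>a = 2b\<close> (\<open>halving\<close>). If \<open>u\<close> is idempotent and \<open>u = 2x\<close>, then
  \<open>2(2x\<^sup>2 - x) = u\<^sup>2 - u = 0\<close>, so \<open>x\<close> solves the equation in (ii) and vanishes
  (\<open>idempotent_eq_0\<close>).

  The group ring \<open>S\<close> has no nonzero idempotent either (\<open>group_ring_idempotent_eq_0\<close>). If
  \<open>a + bg\<close> is idempotent, its augmentation \<open>a + b\<close> is an idempotent of \<open>R\<close>, hence \<open>b = -a\<close>, and
  the coefficient of \<open>e\<close> in \<open>(a - ag)\<^sup>2 = a - ag\<close> is the equation \<open>2a\<^sup>2 = a\<close> of (ii).

  A generalized right p.p. ring, however, is generated as a right ideal by one idempotent,
  because it is the annihilator of \<open>0\<close>. With only the idempotent \<open>0\<close> this forces \<open>S = 0\<close> and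
  \<open>R = 0\<close>, and the zero ring has an identity.

  That \<open>S\<close> is right artinian depends only on the finiteness of \<open>G\<close>: right ideals of \<open>S\<close> are
  \<open>R\<close>-submodules of a finite direct power of \<open>R\<close> (\<open>submodule_chain_stabilizes\<close>).
\<close>

section \<open>Group rings of finite groups over right artinian rings\<close>

text \<open>
  Submodules for right multiplication by the copy of \<open>'a\<close> at the neutral element. Unlike right
  ideals of the group ring, they survive restriction to elements with a vanishing coefficient.
\<close>

definition right_submodule :: "('a::ring, 'g::group_add) group_ring set \<Rightarrow> bool" where
  "right_submodule M \<longleftrightarrow>
     0 \<in> M \<and> (\<forall>x\<in>M. \<forall>y\<in>M. x - y \<in> M) \<and> (\<forall>x\<in>M. \<forall>r. x * Poly_Mapping.single 0 r \<in> M)"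

lemma lookup_times_single_0:
  fixes x :: "('a::ring, 'g::group_add) group_ring"
  shows "Poly_Mapping.lookup (x * Poly_Mapping.single 0 r) h = Poly_Mapping.lookup x h * r"
proof (induction x rule: update_induct)
  case const
  show ?case by simp
next
  case (update f a b)
  have "Poly_Mapping.update a b f = f + Poly_Mapping.single a b"
    using update.hyps(1)
    by (intro poly_mapping_eqI)
      (auto simp: lookup_update lookup_add lookup_single when_def in_keys_iff)
  then show ?case
    using update.IH by (simp add: distrib_right mult_single lookup_add lookup_single when_def)
qed

lemma right_ideal_coefficients:
  assumes "right_submodule M"
  shows "right_ideal ((\<lambda>x. Poly_Mapping.lookup x h) ` M)"
  using assms unfolding right_ideal_def right_submodule_def
  by (auto simp flip: lookup_minus lookup_times_single_0 intro: rev_image_eqI)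

lemma right_submodule_vanishing:
  assumes "right_submodule M"
  shows "right_submodule {x \<in> M. Poly_Mapping.lookup x h = 0}"
  using assms unfolding right_submodule_def
  by (auto simp: lookup_minus lookup_times_single_0)

text \<open>
  The modular law in the form needed for chain conditions: two elements with the same
  coefficient at \<open>h\<close> differ by an element whose coefficient at \<open>h\<close> vanishes.
\<close>

lemma right_submodule_eqI:
  assumes N: "right_submodule N" and M: "right_submodule M" and "N \<subseteq> M"
    and img: "(\<lambda>x. Poly_Mapping.lookup x h) ` N = (\<lambda>x. Poly_Mapping.lookup x h) ` M"
    and ker: "{x \<in> N. Poly_Mapping.lookup x h = 0} = {x \<in> M. Poly_Mapping.lookup x h = 0}"
  shows "N = M"
proof
  show "M \<subseteq> N"
  proof
    fix x assume "x \<in> M"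
    then obtain y where y: "y \<in> N" "Poly_Mapping.lookup x h = Poly_Mapping.lookup y h"
      using img by (metis (no_types, lifting) image_iff)
    have "x - y \<in> M"
      using \<open>x \<in> M\<close> subsetD[OF \<open>N \<subseteq> M\<close> y(1)] M unfolding right_submodule_def by blast
    then have "x - y \<in> {z \<in> M. Poly_Mapping.lookup z h = 0}"
      using y(2) by (simp add: lookup_minus)
    then have "x - y \<in> N"
      unfolding ker[symmetric] by blast
    moreover have "0 - y \<in> N"
      using N y(1) unfolding right_submodule_def by blast
    ultimately have "(x - y) - (0 - y) \<in> N"
      using N unfolding right_submodule_def by blast
    then show "x \<in> N" by simp
  qed
qed (rule \<open>N \<subseteq> M\<close>)

text \<open>
  Induction on the set \<open>A\<close> that contains the supports. Removing one point \<open>h\<close> from \<open>A\<close> splits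
  the chain into the chain of coefficients at \<open>h\<close>, which are right ideals of the coefficient
  ring, and the chain of elements supported in the rest of \<open>A\<close>.
\<close>

lemma submodule_chain_stabilizes:
  fixes M :: "nat \<Rightarrow> ('a::ring, 'g::group_add) group_ring set"
  assumes artinian: "right_artinian TYPE('a)" and "finite A"
    and "\<And>n. right_submodule (M n)" and "\<And>n. M (Suc n) \<subseteq> M n"
    and "\<And>n x. x \<in> M n \<Longrightarrow> Poly_Mapping.keys x \<subseteq> A"
  shows "\<exists>N. \<forall>n\<ge>N. M n = M N"
  using assms(2-)
proof (induction A arbitrary: M rule: finite_induct)
  case empty
  have "M n = {0}" for n
    using empty.prems(1)[of n] empty.prems(3)[of _ n] by (fastforce simp: right_submodule_def)
  then show ?case by simp
next
  case (insert h A)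
  let ?I = "\<lambda>n. (\<lambda>x. Poly_Mapping.lookup x h) ` M n"
  let ?K = "\<lambda>n. {x \<in> M n. Poly_Mapping.lookup x h = 0}"
  have "(\<forall>n. right_ideal (?I n)) \<and> (\<forall>n. ?I (Suc n) \<subseteq> ?I n)"
    using insert.prems(1,2) by (simp add: right_ideal_coefficients image_mono)
  then obtain N1 where N1: "\<And>n. n \<ge> N1 \<Longrightarrow> ?I n = ?I N1"
    using artinian unfolding right_artinian_def by meson
  have "\<exists>N. \<forall>n\<ge>N. ?K n = ?K N"
  proof (rule insert.IH)
    show "right_submodule (?K n)" for n
      using insert.prems(1) by (rule right_submodule_vanishing)
    show "?K (Suc n) \<subseteq> ?K n" for n
      using insert.prems(2) by blast
    show "Poly_Mapping.keys x \<subseteq> A" if "x \<in> ?K n" for x n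
      using that insert.prems(3)[of x n] by (auto simp: in_keys_iff)
  qed
  then obtain N2 where N2: "\<And>n. n \<ge> N2 \<Longrightarrow> ?K n = ?K N2" by meson
  have "M n = M (max N1 N2)" if n: "n \<ge> max N1 N2" for n
  proof (rule right_submodule_eqI[where h = h])
    show "M n \<subseteq> M (max N1 N2)"
      using lift_Suc_antimono_le[of M, OF insert.prems(2) n] .
    show "?I n = ?I (max N1 N2)"
      using N1[of n] N1[of "max N1 N2"] n by simp
    show "?K n = ?K (max N1 N2)"
      using N2[of n] N2[of "max N1 N2"] n by simp
  qed (rule insert.prems(1))+
  then show ?case by blast
qed

lemma right_artinian_group_ring:
  assumes "right_artinian TYPE('a::ring)" and "finite (UNIV :: 'g::group_add set)"
  shows "right_artinian TYPE(('a, 'g) group_ring)"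
  unfolding right_artinian_def
proof (intro allI impI, elim conjE)
  fix I :: "nat \<Rightarrow> ('a, 'g) group_ring set"
  assume ideal: "\<forall>n. right_ideal (I n)" and dec: "\<forall>n. I (Suc n) \<subseteq> I n"
  show "\<exists>N. \<forall>n\<ge>N. I n = I N"
  proof (rule submodule_chain_stabilizes[OF assms])
    show "right_submodule (I n)" for n
      using ideal by (simp add: right_ideal_def right_submodule_def)
  qed (use dec in auto)
qed

section \<open>Division by two and idempotents of the coefficient ring\<close>

lemma nat_multiple_2: "nat_multiple 2 a = a + a"
  by (simp add: nat_multiple_def numeral_2_eq_2)

lemma nat_multiple_diff: "nat_multiple m (a - b) = nat_multiple m a - nat_multiple m b"
  by (simp add: nat_multiple_def sum_subtractf)

lemma nat_multiple_mult_left: "nat_multiple m a * r = nat_multiple m (a * r)"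
  by (simp add: nat_multiple_def sum_distrib_right)

lemma nat_multiple_double: "nat_multiple (2 * m) a = nat_multiple m (a + a)"
  by (induction m) (simp_all add: nat_multiple_def algebra_simps)

lemma right_ideal_range_nat_multiple: "right_ideal (range (nat_multiple m :: 'a::ring \<Rightarrow> 'a))"
  unfolding right_ideal_def
proof (intro conjI ballI allI)
  show "0 \<in> range (nat_multiple m :: 'a \<Rightarrow> 'a)"
    by (rule range_eqI[of _ _ 0]) (simp add: nat_multiple_def)
qed (auto simp: nat_multiple_mult_left simp flip: nat_multiple_diff)

text \<open>
  The right ideals \<open>2\<^sup>n R\<close> form a descending chain; where it becomes constant, cancel the power
  of two.
\<close>

lemma halving:
  fixes a :: "'a::ring"
  assumes artinian: "right_artinian TYPE('a)"
    and torsion: "\<And>(a::'a) n::nat. n > 0 \<Longrightarrow> nat_multiple (2 ^ n) a = 0 \<Longrightarrow> a = 0"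
  shows "\<exists>b. a = b + b"
proof -
  let ?I = "\<lambda>n::nat. range (nat_multiple (2 ^ n) :: 'a \<Rightarrow> 'a)"
  have "\<forall>n. ?I (Suc n) \<subseteq> ?I n"
    by (auto simp: nat_multiple_double)
  then obtain N where N: "\<And>n. n \<ge> N \<Longrightarrow> ?I n = ?I N"
    using artinian right_ideal_range_nat_multiple unfolding right_artinian_def by meson
  \<comment> \<open>Cancellation needs a positive exponent, and the chain may be constant from \<open>N = 0\<close> on.\<close>
  define k where "k = Suc N"
  have "?I (Suc k) = ?I k"
    using N[of "Suc k"] N[of k] by (simp add: k_def)
  then obtain b where "nat_multiple (2 ^ k) a = nat_multiple (2 ^ Suc k) b"
    by (metis rangeE rangeI)
  then have "nat_multiple (2 ^ k) (a - (b + b)) = 0"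
    by (simp add: nat_multiple_double nat_multiple_diff)
  then have "a - (b + b) = 0"
    by (rule torsion[rotated]) (simp add: k_def)
  then show ?thesis by auto
qed

lemma idempotent_eq_0:
  fixes u :: "'a::ring"
  assumes "right_artinian TYPE('a)"
    and torsion: "\<And>(a::'a) n::nat. n > 0 \<Longrightarrow> nat_multiple (2 ^ n) a = 0 \<Longrightarrow> a = 0"
    and trivial: "\<And>x::'a. nat_multiple 2 (x * x) - x = 0 \<Longrightarrow> x = 0"
    and idem: "u * u = u"
  shows "u = 0"
proof -
  obtain x where x: "u = x + x"
    using halving[OF assms(1), of u] torsion by blast
  let ?d = "nat_multiple 2 (x * x) - x"
  have "nat_multiple (2 ^ 1) ?d = u * u - u"
    unfolding power_one_right nat_multiple_2 x by (simp add: algebra_simps)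
  then have "?d = 0"
    using idem torsion[of 1 ?d] by simp
  then have "x = 0" by (rule trivial)
  then show ?thesis using x by simp
qed

section \<open>Idempotents of the group ring of a group of order two\<close>

lemma group_card_2:
  assumes "card (UNIV :: 'g::group_add set) = 2"
  obtains g :: "'g::group_add" where "g \<noteq> 0" "UNIV = {0, g}" "g + g = 0"
proof -
  obtain x y :: 'g where xy: "UNIV = {x, y}" "x \<noteq> y"
    using assms by (auto simp: card_2_iff)
  have "(0::'g) \<in> {x, y}" unfolding xy(1)[symmetric] by (rule UNIV_I)
  moreover define g where "g = (if x = 0 then y else x)"
  ultimately have g: "g \<noteq> 0" "UNIV = {0, g}"
    unfolding xy(1) using xy(2) by auto
  have "g + g \<in> {0, g}" unfolding g(2)[symmetric] by (rule UNIV_I)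
  moreover have "g + g \<noteq> g"
    using g(1) add_left_cancel[of g g 0] by simp
  ultimately have "g + g = 0" by simp
  with g show thesis by (rule that)
qed

lemma group_ring_idempotent_eq_0:
  fixes f :: "('a::ring, 'g::group_add) group_ring"
  assumes no_idem: "\<And>u::'a. u * u = u \<Longrightarrow> u = 0"
    and trivial: "\<And>x::'a. nat_multiple 2 (x * x) - x = 0 \<Longrightarrow> x = 0"
    and "card (UNIV :: 'g set) = 2"
    and idem: "f * f = f"
  shows "f = 0"
proof -
  obtain g :: 'g where g: "g \<noteq> 0" "UNIV = {0, g}" "g + g = 0"
    using assms(3) by (rule group_card_2)
  define a b where "a = Poly_Mapping.lookup f 0" and "b = Poly_Mapping.lookup f g"
  have f: "f = Poly_Mapping.single 0 a + Poly_Mapping.single g b"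
  proof (rule poly_mapping_eqI)
    fix h :: 'g
    have "h = 0 \<or> h = g" using UNIV_I[of h] unfolding g(2) by simp
    then show "Poly_Mapping.lookup f h =
        Poly_Mapping.lookup (Poly_Mapping.single 0 a + Poly_Mapping.single g b) h"
      using g(1) by (auto simp: a_def b_def lookup_add lookup_single when_def)
  qed
  have ff: "f * f = Poly_Mapping.single 0 (a * a + b * b) + Poly_Mapping.single g (a * b + b * a)"
    by (simp add: f distrib_left distrib_right mult_single g(3) single_add add_ac)
  have coeff_e: "a * a + b * b = a"
    using arg_cong[OF trans[OF ff[symmetric] idem], of "\<lambda>x. Poly_Mapping.lookup x 0"] g(1)
    by (simp add: a_def lookup_add lookup_single when_def)
  have coeff_g: "a * b + b * a = b"
    using arg_cong[OF trans[OF ff[symmetric] idem], of "\<lambda>x. Poly_Mapping.lookup x g"] g(1)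
    by (simp add: b_def lookup_add lookup_single when_def)
  have "(a + b) * (a + b) = (a * a + b * b) + (a * b + b * a)"
    by (simp add: algebra_simps)
  then have "a + b = 0"
    using no_idem[of "a + b"] coeff_e coeff_g by simp
  then have b: "b = - a"
    by (simp add: add_eq_0_iff)
  have "a = 0"
    using coeff_e by - (rule trivial, simp add: b nat_multiple_2)
  then show ?thesis by (simp add: f b)
qed

section \<open>Failure of the generalized p.p. condition\<close>

lemma rpow_0: "rpow 0 n = 0"
  unfolding rpow_def by (cases "n - 1") simp_all

text \<open>The annihilator of \<open>0\<close> is the whole ring, so the defining idempotent for \<open>0\<close> generates it.\<close>

lemma generalized_right_pp_imp_idempotent_generator:
  assumes "generalized_right_pp TYPE('s::ring)"
  obtains f :: "'s::ring" where "f * f = f" "\<And>y. \<exists>s. y = f * s"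
proof -
  obtain n and f :: 's where f: "f * f = f" "right_annihilator (rpow 0 n) = {f * s | s. True}"
    using assms unfolding generalized_right_pp_def by blast
  have "\<exists>s. y = f * s" for y
    using f(2) by (auto simp: rpow_0 right_annihilator_def)
  with f(1) show thesis by (rule that)
qed

theorem theorem1:
  assumes "non_unital TYPE('a::ring)"
    and "right_artinian TYPE('a)"
    and "\<And>(a::'a) n::nat. n > 0 \<Longrightarrow> nat_multiple (2 ^ n) a = 0 \<Longrightarrow> a = 0"
    and "\<And>x::'a. nat_multiple 2 (x * x) - x = 0 \<Longrightarrow> x = 0"
    and "card (UNIV :: 'g::group_add set) = 2"
  shows "right_artinian TYPE(('a, 'g) group_ring) \<and>
         \<not> generalized_right_pp TYPE(('a, 'g) group_ring)"
proof
  have "finite (UNIV :: 'g set)"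
    using assms(5) by (intro card_ge_0_finite) simp
  with assms(2) show "right_artinian TYPE(('a, 'g) group_ring)"
    by (rule right_artinian_group_ring)
  show "\<not> generalized_right_pp TYPE(('a, 'g) group_ring)"
  proof
    assume "generalized_right_pp TYPE(('a, 'g) group_ring)"
    then obtain f :: "('a, 'g) group_ring" where f: "f * f = f" "\<And>y. \<exists>s. y = f * s"
      by (rule generalized_right_pp_imp_idempotent_generator) blast
    have "u = 0" if "u * u = u" for u :: 'a
      using idempotent_eq_0[OF assms(2) _ _ that] assms(3,4) by blast
    then have "f = 0"
      using group_ring_idempotent_eq_0[OF _ _ assms(5) f(1)] assms(4) by blast
    then have S0: "y = 0" for y :: "('a, 'g) group_ring"
      using f(2)[of y] by simp
    have R0: "x = 0" for x :: 'a
      using S0[of "Poly_Mapping.single 0 x"] by (metis lookup_single_eq lookup_zero)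
    then have "\<forall>x::'a. 0 * x = x \<and> x * 0 = x"
      by simp
    then show False
      using assms(1) unfolding non_unital_def by blast
  qed
qed

end
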